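(* Let $\mathcal{D}$ be a finite rooted DAG with node features that is not a rooted tree (i.e., at least one node of $\mathcal{D}$ has more than one outgoing edge), and let $\gamma(\mathcal{D})$ be its computation tree. Then there exists a flow-attentional directed acyclic GNN $\mathcal{A}_{\text{flow}}$ such that $$\mathcal{A}_{\text{flow}}(\mathcal{D}) \neq \mathcal{A}_{\text{flow}}(\gamma(\mathcal{D})).$$
   Context: Graphs. A directed graph is $\mathcal{G}=(\mathcal{V},\mathcal{E})$ with $\mathcal{V}$ finite and $\mathcal{E}\subseteq\mathcal{V}\times\mathcal{V}$; $(u,v)\in\mathcal{E}$ is the edge from $u$ to $v$. Write $\mathcal{N}_{\text{in}}(v)=\{u:(u,v)\in\mathcal{E}\}$ (predecessors) and $\mathcal{N}_{\text{out}}(v)=\{u:(v,u)\in\mathcal{E}\}$ (successors). A DAG is a directed graph without directed cycles. A rooted DAG is a DAG with a unique node $r$ (the root, or final node) having no successors. Every node $i$ carries an initial feature vector $\bm{h}_i\in\mathbb{R}^{\rho}$, $\rho\ge 1$. A rooted tree is a rooted DAG in which every node has at most one outgoing edge. Computation tree. For a rooted DAG $\mathcal{D}$ with root $r$, the computation tree $\gamma(\mathcal{D})$ is obtained by leaving each node with at most one successor unchanged and replacing any node $v$ with $n\ge 2$ successors by $n$ copies $v_1,\dots,v_n$ (carrying the same feature vector as $v$), each connected to exactly one of $v$'s successors and inheriting all of $v$'s incoming edges, until every node has at most one successor. The result is a rooted tree with root $r$. Equivalently: the nodes of $\gamma(\mathcal{D})$ are the directed paths of $\mathcal{D}$ ending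 in $r$ (including the trivial path at $r$); the path $(v_0,v_1,\dots,v_p=r)$ with $p\ge1$ has as its unique successor the path $(v_1,\dots,v_p)$; and the path starting at $v_0$ carries the feature $\bm{h}_{v_0}$. Flow-attentional directed acyclic GNN. One layer is given by a scoring function $e$ (real-valued, with two vector arguments), a message function $f$ and an update function $\phi$ (arbitrary functions between real vector spaces of suitable finite dimensions). It processes the nodes of a DAG in an order compatible with the edges and computes $$\bm{h}_i' = \phi\Bigl(\bm{h}_i,\ \sum_{j\in\mathcal{N}_{\text{in}}(i)} \beta_{ij}\, f(\bm{h}_j')\Bigr),\qquad \beta_{ij}=\frac{\exp(e_{ij})}{\sum_{k\in\mathcal{N}_{\text{out}}(j)}\exp(e_{kj})},\qquad e_{ij}=e(\bm{h}_i,\bm{h}_j'),$$ where the empty sum (for nodes without predecessors) is $0$. A flow-attentional directed acyclic GNN $\mathcal{A}_{\text{flow}}$ is a composition of one or more such layers (each layer's outputs $\bm{h}_i'$ are the next layer's inputs $\bm{h}_i$), and its value $\mathcal{A}_{\text{flow}}(\mathcal{D})$ on a rooted DAG $\mathcal{D}$ is the representation of the root $r$ after the last layer. *)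

theory Defs
  imports "Graph_Theory.Graph_Theory" "Jordan_Normal_Form.Matrix"
begin

definition preds :: "'a pair_pre_digraph \<Rightarrow> 'a \<Rightarrow> 'a set" where
  "preds G v = {u. (u, v) \<in> parcs G}"

definition succs :: "'a pair_pre_digraph \<Rightarrow> 'a \<Rightarrow> 'a set" where
  "succs G v = {u. (v, u) \<in> parcs G}"

locale rooted_dag = pair_fin_digraph G for G :: "'a pair_pre_digraph" +
  assumes acyclic_arcs: "acyclic (parcs G)"
    and ex1_root: "\<exists>!r. r \<in> pverts G \<and> succs G r = {}"

definition dag_root :: "'a pair_pre_digraph \<Rightarrow> 'a" where
  "dag_root G = (THE r. r \<in> pverts G \<and> succs G r = {})"

definition rooted_tree :: "'a pair_pre_digraph \<Rightarrow> bool" where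
  "rooted_tree G \<longleftrightarrow> rooted_dag G \<and> (\<forall>v\<in>pverts G. card (succs G v) \<le> 1)"

text \<open>The nodes of the computation tree are the directed paths (as vertex lists) that end in the
  root; a path has as its unique successor the path without its first vertex, and it carries the
  feature vector of its first vertex.\<close>

definition comp_tree :: "'a pair_pre_digraph \<Rightarrow> 'a list pair_pre_digraph" where
  "comp_tree G =
    (let P = {p. vpath p (with_proj G) \<and> last p = dag_root G}
     in \<lparr> pverts = P, parcs = {(v # p, p) |v p. v # p \<in> P \<and> p \<in> P} \<rparr>)"

definition comp_tree_feat :: "('a \<Rightarrow> 'b) \<Rightarrow> 'a list \<Rightarrow> 'b" where
  "comp_tree_feat h p = h (hd p)"

text \<open>Different layers may use different dimensions, hence vectors are taken from
  \<^const>\<open>carrier_vec\<close> rather than from a type of fixed dimension.\<close>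

record flow_layer =
  in_dim :: nat
  msg_dim :: nat
  out_dim :: nat
  score :: "real vec \<Rightarrow> real vec \<Rightarrow> real"
  msg :: "real vec \<Rightarrow> real vec"
  upd :: "real vec \<Rightarrow> real vec \<Rightarrow> real vec"

definition layer_wf :: "flow_layer \<Rightarrow> bool" where
  "layer_wf L \<longleftrightarrow>
    msg L \<in> carrier_vec (out_dim L) \<rightarrow> carrier_vec (msg_dim L) \<and>
    upd L \<in> carrier_vec (in_dim L) \<rightarrow> carrier_vec (msg_dim L) \<rightarrow> carrier_vec (out_dim L)"

text \<open>The first argument of the scoring function is the layer's input vector of the receiving
  node \<open>i\<close>, the second one is the output vector of the sending node \<open>j\<close>; the weights
  are normalised over the successors of \<open>j\<close>.\<close>

definition flow_weight ::
  "'a pair_pre_digraph \<Rightarrow> flow_layer \<Rightarrow> ('a \<Rightarrow> real vec) \<Rightarrow> ('a \<Rightarrow> real vec) \<Rightarrow> 'a \<Rightarrow> 'a \<Rightarrow> real"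
  where
  "flow_weight G L h h' i j =
    exp (score L (h i) (h' j)) / (\<Sum>k\<in>succs G j. exp (score L (h k) (h' j)))"

definition layer_step ::
  "'a pair_pre_digraph \<Rightarrow> flow_layer \<Rightarrow> ('a \<Rightarrow> real vec) \<Rightarrow> ('a \<Rightarrow> real vec) \<Rightarrow> 'a \<Rightarrow> real vec"
  where
  "layer_step G L h h' i =
    upd L (h i)
      (finsum_vec TYPE(real) (msg_dim L) (\<lambda>j. flow_weight G L h h' i j \<cdot>\<^sub>v msg L (h' j)) (preds G i))"

text \<open>The outputs of a layer are computed by recursion along the edges; on a finite DAG they are the
  unique solution of the layer equations, see \<open>layer_out_eq\<close> and \<open>layer_out_unique\<close> below.\<close>

definition layer_out ::
  "'a pair_pre_digraph \<Rightarrow> flow_layer \<Rightarrow> ('a \<Rightarrow> real vec) \<Rightarrow> 'a \<Rightarrow> real vec" where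
  "layer_out G L h = wfrec (parcs G) (layer_step G L h)"

fun layers_wf :: "nat \<Rightarrow> flow_layer list \<Rightarrow> bool" where
  "layers_wf d [] \<longleftrightarrow> True"
| "layers_wf d (L # Ls) \<longleftrightarrow> layer_wf L \<and> in_dim L = d \<and> layers_wf (out_dim L) Ls"

definition flow_gnn :: "nat \<Rightarrow> flow_layer list \<Rightarrow> bool" where
  "flow_gnn d Ls \<longleftrightarrow> Ls \<noteq> [] \<and> layers_wf d Ls"

fun layers_out ::
  "flow_layer list \<Rightarrow> 'a pair_pre_digraph \<Rightarrow> ('a \<Rightarrow> real vec) \<Rightarrow> 'a \<Rightarrow> real vec" where
  "layers_out [] G h = h"
| "layers_out (L # Ls) G h = layers_out Ls G (layer_out G L h)"

definition gnn_value ::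
  "flow_layer list \<Rightarrow> 'a pair_pre_digraph \<Rightarrow> ('a \<Rightarrow> real vec) \<Rightarrow> real vec" where
  "gnn_value Ls G h = layers_out Ls G h (dag_root G)"

lemma foldSetD_cong:
  assumes "(A, x) \<in> foldSetD D f e" "\<And>a. a \<in> A \<Longrightarrow> f a = g a"
  shows "(A, x) \<in> foldSetD D g e"
  using assms by (induction rule: foldSetD.induct) (auto intro: foldSetD.intros)

lemma finsum_vec_cong:
  assumes "\<And>a. a \<in> A \<Longrightarrow> f a = g a"
  shows "finsum_vec TYPE(real) n f A = finsum_vec TYPE(real) n g A"
proof -
  have "((A, x) \<in> foldSetD D (k \<circ> f) e) = ((A, x) \<in> foldSetD D (k \<circ> g) e)"
    for x D e and k :: "real vec \<Rightarrow> real vec \<Rightarrow> real vec"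
    using foldSetD_cong[where f = "k \<circ> f" and g = "k \<circ> g"]
      foldSetD_cong[where f = "k \<circ> g" and g = "k \<circ> f"] assms
    by (metis comp_apply)
  then show ?thesis
    unfolding finsum_vec_def finprod_def foldD_def by simp
qed

lemma layer_step_cong:
  assumes "\<And>j. (j, i) \<in> parcs G \<Longrightarrow> f j = g j"
  shows "layer_step G L h f i = layer_step G L h g i"
proof -
  have "finsum_vec TYPE(real) (msg_dim L) (\<lambda>j. flow_weight G L h f i j \<cdot>\<^sub>v msg L (f j)) (preds G i)
    = finsum_vec TYPE(real) (msg_dim L) (\<lambda>j. flow_weight G L h g i j \<cdot>\<^sub>v msg L (g j)) (preds G i)"
    by (rule finsum_vec_cong) (simp add: assms preds_def flow_weight_def)
  then show ?thesis by (simp add: layer_step_def)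
qed

context rooted_dag
begin

lemma wf_arcs: "wf (parcs G)"
  using acyclic_arcs pair_finite_arcs by (rule finite_acyclic_wf[rotated])

lemma layer_out_eq: "layer_out G L h i = layer_step G L h (layer_out G L h) i"
proof -
  have "layer_out G L h i = layer_step G L h (cut (layer_out G L h) (parcs G) i) i"
    unfolding layer_out_def by (rule wfrec[OF wf_arcs])
  also have "\<dots> = layer_step G L h (layer_out G L h) i"
    by (rule layer_step_cong) (simp add: cut_apply)
  finally show ?thesis .
qed

lemma layer_out_unique:
  assumes "\<And>i. i \<in> pverts G \<Longrightarrow> h' i = layer_step G L h h' i" and "i \<in> pverts G"
  shows "h' i = layer_out G L h i"
  using assms(2)
proof (induction i rule: wf_induct_rule[OF wf_arcs])
  case (1 i)
  have "h' i = layer_step G L h h' i" using assms(1) 1 by blast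
  also have "\<dots> = layer_step G L h (layer_out G L h) i"
    using 1 in_arcsD1 by (blast intro: layer_step_cong)
  finally show ?case by (simp add: layer_out_eq[symmetric])
qed

lemma dag_root: "dag_root G \<in> pverts G" "succs G (dag_root G) = {}"
  using theI'[OF ex1_root] by (auto simp: dag_root_def)

lemma comp_tree_node:
  assumes "p \<in> pverts (comp_tree G)"
  shows "p \<noteq> []" "set p \<subseteq> pverts G" "length p \<le> card (pverts G)"
proof -
  show "p \<noteq> []" and *: "set p \<subseteq> pverts G"
    using assms by (auto simp: comp_tree_def Let_def vpath_def vwalk_def)
  have "distinct p"
    using assms by (simp add: comp_tree_def Let_def vpath_def)
  then show "length p \<le> card (pverts G)"
    using card_mono[OF pair_finite_verts *] by (simp add: distinct_card)
qed

lemma finite_comp_tree: "finite (pverts (comp_tree G))"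
proof (rule finite_subset)
  show "pverts (comp_tree G) \<subseteq> {p. set p \<subseteq> pverts G \<and> length p \<le> card (pverts G)}"
    using comp_tree_node by blast
  show "finite {p. set p \<subseteq> pverts G \<and> length p \<le> card (pverts G)}"
    by (rule finite_lists_length_le) (rule pair_finite_verts)
qed

lemma comp_tree_tl:
  assumes "p \<in> pverts (comp_tree G)" "tl p \<noteq> []"
  shows "tl p \<in> pverts (comp_tree G)"
  using assms
  by (cases p rule: vwalk_arcs.cases) (auto simp: comp_tree_def Let_def vpath_def vwalk_def)

lemma succs_comp_tree:
  assumes "p \<in> pverts (comp_tree G)"
  shows "succs (comp_tree G) p = (if tl p = [] then {} else {tl p})"
proof -
  have *: "[] \<notin> pverts (comp_tree G)" and "p \<noteq> []"
    using assms by (auto simp: comp_tree_def Let_def vpath_def vwalk_def)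
  then obtain v q where "p = v # q" by (cases p) auto
  with comp_tree_tl[OF assms] assms * show ?thesis
    by (auto simp: comp_tree_def Let_def succs_def)
qed

lemma comp_tree_singleton:
  "p \<in> pverts (comp_tree G) \<and> tl p = [] \<longleftrightarrow> p = [dag_root G]"
  using dag_root(1)
  by (cases p) (auto simp: comp_tree_def Let_def vpath_def vwalk_def)

lemma rooted_tree_comp_tree: "rooted_tree (comp_tree G)"
proof -
  let ?T = "comp_tree G"
  have sub: "parcs ?T \<subseteq> pverts ?T \<times> pverts ?T"
    by (auto simp: comp_tree_def Let_def)
  have "rooted_dag ?T"
  proof
    show "acyclic (parcs ?T)"
    proof (rule acyclic_subset)
      show "acyclic ((measure length)\<inverse> :: 'a list rel)"
        by (simp add: wf_acyclic)
      show "parcs ?T \<subseteq> (measure length)\<inverse>"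
        by (auto simp: comp_tree_def Let_def)
    qed
    show "finite (parcs ?T)"
      using sub finite_comp_tree by (meson finite_SigmaI finite_subset)
    show "\<exists>!r. r \<in> pverts ?T \<and> succs ?T r = {}"
      using comp_tree_singleton succs_comp_tree by (metis insert_not_empty)
  qed (use sub finite_comp_tree in auto)
  then show ?thesis
    unfolding rooted_tree_def using succs_comp_tree by simp
qed

end

end

theory Submission
  imports Defs
begin

text \<open>Take a single layer with constant score in which every node sends on all that it received
  plus one unit of its own. The attention weights of a sender add up to one, so flow is conserved,
  and the root of a rooted DAG receives exactly one unit per node: its value is the number of
  nodes. The computation tree has at least as many nodes as the DAG, and strictly more as soon as
  some node has two successors, since this node then starts two different paths to the root.\<close>

definition counting_layer :: "nat \<Rightarrow> flow_layer" where
  "counting_layer d =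
    \<lparr> in_dim = d, msg_dim = 1, out_dim = 1, score = (\<lambda>_ _. 0), msg = (\<lambda>x. x),
      upd = (\<lambda>_ s. vec 1 (\<lambda>_. 1 + s $ 0)) \<rparr>"

lemma flow_gnn_counting_layer: "flow_gnn d [counting_layer d]"
  by (auto simp: flow_gnn_def layer_wf_def counting_layer_def)

context rooted_dag
begin

lemma finite_preds: "finite (preds G v)" and finite_succs: "finite (succs G v)"
  and preds_subset: "preds G v \<subseteq> pverts G" and succs_subset: "succs G v \<subseteq> pverts G"
proof -
  show "preds G v \<subseteq> pverts G" "succs G v \<subseteq> pverts G"
    by (auto simp: preds_def succs_def dest: in_arcsD1 in_arcsD2)
  then show "finite (preds G v)" "finite (succs G v)"
    by (auto intro: finite_subset pair_finite_verts)
qed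

lemma succs_eq_empty_iff:
  assumes "v \<in> pverts G"
  shows "succs G v = {} \<longleftrightarrow> v = dag_root G"
  using assms ex1_root dag_root by blast

lemma layer_out_counting_layer_carrier: "layer_out G (counting_layer d) h i \<in> carrier_vec 1"
  by (subst layer_out_eq) (simp add: layer_step_def counting_layer_def)

text \<open>The constant score makes the attention uniform, so each sender splits its value evenly
  among its successors. The layer thus reduces to a recursion on reals.\<close>

lemma layer_out_counting_layer_eq:
  "layer_out G (counting_layer d) h i $ 0 =
    1 + (\<Sum>j\<in>preds G i. layer_out G (counting_layer d) h j $ 0 / card (succs G j))"
proof -
  let ?x = "layer_out G (counting_layer d) h"
  have "?x i $ 0 = 1 + finsum_vec TYPE(real) 1
      (\<lambda>j. flow_weight G (counting_layer d) h ?x i j \<cdot>\<^sub>v ?x j) (preds G i) $ 0"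
    by (subst layer_out_eq) (simp add: layer_step_def counting_layer_def)
  also have "\<dots> = 1 + (\<Sum>j\<in>preds G i.
      (flow_weight G (counting_layer d) h ?x i j \<cdot>\<^sub>v ?x j) $ 0)"
    using layer_out_counting_layer_carrier[of d h]
    by (subst index_finsum_vec) (auto simp: finite_preds)
  also have "\<dots> = 1 + (\<Sum>j\<in>preds G i. ?x j $ 0 / card (succs G j))"
  proof -
    \<comment> \<open>Entry \<open>0\<close> of a scaled vector can be evaluated only once
      \<open>0\<close> is known to be below its dimension.\<close>
    have "dim_vec (?x j) = 1" for j
      using layer_out_counting_layer_carrier by (rule carrier_vecD)
    moreover have "flow_weight G (counting_layer d) h ?x i j = 1 / card (succs G j)" for j
      by (simp add: flow_weight_def counting_layer_def)
    ultimately show ?thesis by simp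
  qed
  finally show ?thesis .
qed

text \<open>Sum the recursion over all nodes and regroup the double sum by sender: the value of
  every node except the root occurs on both sides and cancels.\<close>

lemma layer_out_counting_layer_root:
  "layer_out G (counting_layer d) h (dag_root G) $ 0 = card (pverts G)"
proof -
  let ?r = "dag_root G"
  define x where "x i = layer_out G (counting_layer d) h i $ 0" for i
  have "(\<Sum>i\<in>pverts G. x i)
      = card (pverts G) + (\<Sum>i\<in>pverts G. \<Sum>j\<in>preds G i. x j / card (succs G j))"
    unfolding x_def by (subst layer_out_counting_layer_eq) (simp add: sum.distrib)
  also have "(\<Sum>i\<in>pverts G. \<Sum>j\<in>preds G i. x j / card (succs G j))
      = (\<Sum>i\<in>pverts G. \<Sum>j | j \<in> pverts G \<and> (j, i) \<in> parcs G. x j / card (succs G j))"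
    using preds_subset by (intro sum.cong refl) (auto simp: preds_def)
  also have "\<dots> = (\<Sum>j\<in>pverts G. \<Sum>i | i \<in> pverts G \<and> (j, i) \<in> parcs G. x j / card (succs G j))"
    by (rule sum.swap_restrict) (auto intro: pair_finite_verts)
  also have "\<dots> = (\<Sum>j\<in>pverts G. \<Sum>i\<in>succs G j. x j / card (succs G j))"
    using succs_subset by (intro sum.cong refl) (auto simp: succs_def)
  \<comment> \<open>The root has an empty inner sum; any other node has a successor, so its equal
    shares add up to its value.\<close>
  also have "\<dots> = (\<Sum>j\<in>pverts G. if j = ?r then 0 else x j)"
    using succs_eq_empty_iff finite_succs by (intro sum.cong) auto
  also have "\<dots> = (\<Sum>j\<in>pverts G - {?r}. x j)"
    using dag_root(1) pair_finite_verts by (simp add: sum.remove[of _ ?r])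
  finally show ?thesis
    using dag_root(1) pair_finite_verts by (simp add: sum.remove[of _ ?r] x_def)
qed

text \<open>Serves to turn a repeated vertex on a walk into a directed cycle.\<close>

lemma vwalk_reachable:
  assumes "vwalk p (with_proj G)" "x \<in> set p"
  shows "(hd p, x) \<in> (parcs G)\<^sup>*"
  using assms
proof (induction p)
  case (Cons u v es)
  then have "(u, v) \<in> parcs G" by (simp add: arcs_ends_def arc_to_ends_def)
  with Cons show ?case by (auto intro: converse_rtrancl_into_rtrancl)
qed simp

text \<open>Tree nodes are paths with distinct vertices; acyclicity keeps the new first vertex from
  occurring again.\<close>

lemma comp_tree_Cons:
  assumes "p \<in> pverts (comp_tree G)" "(v, hd p) \<in> parcs G"
  shows "v # p \<in> pverts (comp_tree G)"
proof -
  have p: "vwalk p (with_proj G)" "distinct p" "last p = dag_root G" "p \<noteq> []"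
    using assms(1) comp_tree_node(1) by (auto simp: comp_tree_def Let_def vpath_def)
  have "v \<notin> set p"
  proof
    assume "v \<in> set p"
    then have "(hd p, v) \<in> (parcs G)\<^sup>*" by (rule vwalk_reachable[OF p(1)])
    with assms(2) have "(v, v) \<in> (parcs G)\<^sup>+" by (rule rtrancl_into_trancl2)
    with acyclic_arcs show False by (simp add: acyclic_def)
  qed
  moreover have "vwalk (v # p) (with_proj G)"
    using p assms(2) in_arcsD1 by (cases p) (auto simp: vwalk_def)
  ultimately show ?thesis
    using p by (simp add: comp_tree_def Let_def vpath_def)
qed

text \<open>Every vertex starts some path to the root: following successors must end, and only the
  root has none.\<close>

lemma hd_comp_tree: "hd ` pverts (comp_tree G) = pverts G"
proof
  show "hd ` pverts (comp_tree G) \<subseteq> pverts G"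
    using comp_tree_node by fastforce
  have "wf ((parcs G)\<inverse>)"
    using acyclic_arcs pair_finite_arcs by (simp add: finite_acyclic_wf_converse)
  then have "v \<in> pverts G \<Longrightarrow> v \<in> hd ` pverts (comp_tree G)" for v
  proof (induction v rule: wf_induct_rule)
    case (less v)
    show ?case
    proof (cases "v = dag_root G")
      case True
      then show ?thesis using comp_tree_singleton by force
    next
      case False
      then obtain u where u: "(v, u) \<in> parcs G"
        using less.prems succs_eq_empty_iff by (auto simp: succs_def)
      then obtain p where "p \<in> pverts (comp_tree G)" "hd p = u"
        using less.IH[of u] in_arcsD2 by auto
      then have "v # p \<in> pverts (comp_tree G)" using u comp_tree_Cons by simp
      then show ?thesis by force
    qed
  qed
  then show "pverts G \<subseteq> hd ` pverts (comp_tree G)" by blast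
qed

text \<open>The map \<open>hd\<close> from tree nodes onto vertices is not injective, since a
  branching vertex heads paths through two different successors.\<close>

lemma card_comp_tree_greater:
  assumes "\<not> rooted_tree G"
  shows "card (pverts G) < card (pverts (comp_tree G))"
proof -
  obtain v where v: "\<not> card (succs G v) \<le> 1"
    using assms rooted_dag_axioms by (auto simp: rooted_tree_def)
  then obtain a b where ab: "a \<in> succs G v" "b \<in> succs G v" "a \<noteq> b"
    using card_le_Suc0_iff_eq[OF finite_succs] by auto
  then have "a \<in> hd ` pverts (comp_tree G)" "b \<in> hd ` pverts (comp_tree G)"
    using succs_subset unfolding hd_comp_tree by blast+
  then obtain p q where p: "p \<in> pverts (comp_tree G)" "hd p = a"
    and q: "q \<in> pverts (comp_tree G)" "hd q = b"
    by blast
  have "v # p \<in> pverts (comp_tree G)" "v # q \<in> pverts (comp_tree G)"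
    using p q ab comp_tree_Cons by (auto simp: succs_def)
  moreover have "p \<noteq> q" using p q ab by auto
  ultimately have "\<not> inj_on hd (pverts (comp_tree G))"
    using inj_onD[of hd _ "v # p" "v # q"] by auto
  then show ?thesis
    using inj_on_iff_eq_card[OF finite_comp_tree, of hd] card_image_le[OF finite_comp_tree, of hd]
    by (simp add: hd_comp_tree)
qed

end

theorem theorem5p4:
  fixes D :: "'a pair_pre_digraph" and h :: "'a \<Rightarrow> real vec" and \<rho> :: nat
  assumes "rooted_dag D"
    and "\<rho> \<ge> 1"
    and "\<And>v. v \<in> pverts D \<Longrightarrow> h v \<in> carrier_vec \<rho>"
    and "\<not> rooted_tree D"
  shows "\<exists>Ls. flow_gnn \<rho> Ls \<and>
    gnn_value Ls D h \<noteq> gnn_value Ls (comp_tree D) (comp_tree_feat h)"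
proof (intro exI conjI)
  interpret D: rooted_dag D by (rule assms(1))
  \<comment> \<open>The tree is itself a rooted DAG, so the same node count applies to it.\<close>
  interpret T: rooted_dag "comp_tree D"
    using D.rooted_tree_comp_tree by (simp add: rooted_tree_def)
  show "flow_gnn \<rho> [counting_layer \<rho>]" by (rule flow_gnn_counting_layer)
  show "gnn_value [counting_layer \<rho>] D h
    \<noteq> gnn_value [counting_layer \<rho>] (comp_tree D) (comp_tree_feat h)"
    \<comment> \<open>Equal root vectors would agree at entry \<open>0\<close>, forcing equal node
      counts.\<close>
    using D.layer_out_counting_layer_root[of \<rho> h]
      T.layer_out_counting_layer_root[of \<rho> "comp_tree_feat h"]
      D.card_comp_tree_greater[OF assms(4)]
    by (auto simp: gnn_value_def)
qed

end
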